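(* Let $n\ge 1$ and $w\in S_n$. The support of the dual Schubert polynomial $D^w$ is \[\mathrm{supp}(D^w)=\sum_{(a,b)\in \mathrm{Inv}(w)}\{e_a,e_{a+1},\dots,e_{b-1}\},\] where the right-hand side is the Minkowski sum (in $\mathbb{Z}^{n-1}$) of the sets $\{e_a,e_{a+1},\dots,e_{b-1}\}$ of standard basis vectors, one set for each inversion $(a,b)$ of $w$ (the empty Minkowski sum being $\{0\}$).
   Context: $S_n$ is the symmetric group on $[n]=\{1,\dots,n\}$, permutations written in one-line notation $w=w(1)\cdots w(n)$. An inversion of $w$ is a pair $(a,b)$ with $1\le a<b\le n$ and $w(a)>w(b)$; $\mathrm{Inv}(w)$ is the set of inversions and $\ell(w)=|\mathrm{Inv}(w)|$ is the length. For $a<b$, $wt_{ab}$ denotes the permutation obtained from $w$ by swapping the entries in positions $a$ and $b$. In the (strong) Bruhat order, $u\lessdot v$ (cover) iff $v=ut_{ab}$ for some $a<b$ and $\ell(v)=\ell(u)+1$. The edge $u\lessdot ut_{ab}$ has weight $m(u\lessdot ut_{ab})=x_a+x_{a+1}+\dots+x_{b-1}$, and a saturated chain $C=(u_0\lessdot u_1\lessdot\cdots\lessdot u_\ell)$ has weight $m_C=\prod_{i=1}^{\ell} m(u_{i-1}\lessdot u_i)$. The dual Schubert polynomial is $D^w(x_1,\dots,x_{n-1})=\frac{1}{\ell(w)!}\sum_C m_C$, summed over all saturated chains $C$ from the identity to $w$. The support $\mathrm{supp}(f)$ of a polynomial $f=\sum_\alpha c_\alpha x^\alpha$ is the set of exponent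 vectors $\alpha$ with $c_\alpha\ne 0$; $e_i$ denotes the $i$-th standard basis vector of $\mathbb{Z}^{n-1}$. *)

theory Defs
  imports
    Complex_Main
    "HOL-Combinatorics.Permutations"
    "HOL-Library.Poly_Mapping"
    "HOL-Library.Set_Algebras"
begin

text \<open>An element of the symmetric group on \<open>[n]\<close> is a function \<open>w :: nat \<Rightarrow> nat\<close> with
  \<open>w permutes {1..n}\<close>.\<close>

definition inversions :: "nat \<Rightarrow> (nat \<Rightarrow> nat) \<Rightarrow> (nat \<times> nat) set" where
  "inversions n w = {(a, b). 1 \<le> a \<and> a < b \<and> b \<le> n \<and> w a > w b}"

lemma finite_inversions: "finite (inversions n w)"
  by (rule finite_subset[of _ "{1..n} \<times> {1..n}"]) (auto simp: inversions_def)

definition perm_length :: "nat \<Rightarrow> (nat \<Rightarrow> nat) \<Rightarrow> nat" where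
  "perm_length n w = card (inversions n w)"

definition bruhat_cover :: "nat \<Rightarrow> (nat \<Rightarrow> nat) \<Rightarrow> (nat \<Rightarrow> nat) \<Rightarrow> bool" where
  "bruhat_cover n u v \<longleftrightarrow> u permutes {1..n} \<and>
     (\<exists>a b. 1 \<le> a \<and> a < b \<and> b \<le> n \<and> v = u \<circ> transpose a b \<and>
            perm_length n v = perm_length n u + 1)"

text \<open>A polynomial is a finitely supported map from exponent vectors to coefficients, and an
  exponent vector is a finitely supported map \<open>nat \<Rightarrow>\<^sub>0 nat\<close>; the support of \<open>f\<close> is then
  \<open>keys f\<close>. The index \<open>i\<close> of a variable is the 1-based index of \<open>x\<^sub>i\<close>.\<close>

type_synonym mpoly_rat = "(nat \<Rightarrow>\<^sub>0 nat) \<Rightarrow>\<^sub>0 rat"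

definition unit_exp :: "nat \<Rightarrow> (nat \<Rightarrow>\<^sub>0 nat)" where
  "unit_exp i = Poly_Mapping.single i 1"

definition Var :: "nat \<Rightarrow> mpoly_rat" where
  "Var i = Poly_Mapping.single (unit_exp i) 1"

definition Const :: "rat \<Rightarrow> mpoly_rat" where
  "Const c = Poly_Mapping.single 0 c"

text \<open>The positions \<open>a < b\<close> are recovered from the two endpoints of an edge; by
  \<open>edge_weight_transpose\<close> below they are unique.\<close>

definition edge_weight :: "(nat \<Rightarrow> nat) \<Rightarrow> (nat \<Rightarrow> nat) \<Rightarrow> mpoly_rat" where
  "edge_weight u v =
     (case (THE (a, b). a < b \<and> v = u \<circ> transpose a b) of (a, b) \<Rightarrow> \<Sum>i\<in>{a..<b}. Var i)"

text \<open>A chain \<open>u\<^sub>0, \<dots>, u\<^sub>\<ell>\<close> is the list of its elements; the one-element list is the chain of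
  length \<open>0\<close>.\<close>

definition saturated_chains :: "nat \<Rightarrow> (nat \<Rightarrow> nat) \<Rightarrow> (nat \<Rightarrow> nat) list set" where
  "saturated_chains n w =
     {us. us \<noteq> [] \<and> hd us = id \<and> last us = w \<and> successively (bruhat_cover n) us}"

definition chain_weight :: "(nat \<Rightarrow> nat) list \<Rightarrow> mpoly_rat" where
  "chain_weight us = (\<Prod>i<length us - 1. edge_weight (us ! i) (us ! Suc i))"

definition dual_schubert :: "nat \<Rightarrow> (nat \<Rightarrow> nat) \<Rightarrow> mpoly_rat" where
  "dual_schubert n w =
     Const (1 / fact (perm_length n w)) * (\<Sum>us\<in>saturated_chains n w. chain_weight us)"

lemma edge_weight_transpose:
  assumes "inj u" "a < b"
  shows "edge_weight u (u \<circ> transpose a b) = (\<Sum>i\<in>{a..<b}. Var i)"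
proof -
  have "(THE (a', b'). a' < b' \<and> u \<circ> transpose a b = u \<circ> transpose a' b') = (a, b)"
  proof (rule the_equality)
    show "case (a, b) of (a', b') \<Rightarrow> a' < b' \<and> u \<circ> transpose a b = u \<circ> transpose a' b'"
      using assms by simp
  next
    fix p :: "nat \<times> nat"
    assume "case p of (a', b') \<Rightarrow> a' < b' \<and> u \<circ> transpose a b = u \<circ> transpose a' b'"
    then obtain a' b' where p: "p = (a', b')" "a' < b'"
      and eq: "u \<circ> transpose a b = u \<circ> transpose a' b'" by (cases p) auto
    have tr: "transpose a b i = transpose a' b' i" for i
      using fun_cong[OF eq, of i] injD[OF assms(1)] by simp
    show "p = (a, b)"
      using tr[of a] tr[of b] p assms(2) by (auto simp: transpose_def split: if_splits)
  qed
  then show ?thesis by (simp add: edge_weight_def)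
qed

text \<open>The sum in \<open>dual_schubert\<close> ranges over a finite set, so it is not the junk value \<open>0\<close>.\<close>

lemma finite_saturated_chains:
  "finite (saturated_chains n w)"
proof -
  have cov: "v permutes {1..n}" if "bruhat_cover n u v" for u v
    using that unfolding bruhat_cover_def
    by (auto intro!: permutes_compose permutes_swap_id)
  have bound: "perm_length n v \<ge> length us \<and> set us \<subseteq> {u. u permutes {1..n}}"
    if "successively (bruhat_cover n) (us @ [v])" for us v
    using that
  proof (induction us arbitrary: v rule: rev_induct)
    case (snoc u us)
    have *: "successively (bruhat_cover n) (us @ [u])" "bruhat_cover n u v"
      using snoc.prems by (auto simp: successively_append_iff)
    then have "perm_length n v = perm_length n u + 1" "u permutes {1..n}"
      by (auto simp: bruhat_cover_def)
    with snoc.IH[OF *(1)] show ?case by auto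
  qed simp
  have "saturated_chains n w \<subseteq>
      (\<lambda>us. us @ [w]) ` {us. set us \<subseteq> {u. u permutes {1..n}} \<and> length us \<le> perm_length n w}"
  proof
    fix us assume "us \<in> saturated_chains n w"
    then have us: "us = butlast us @ [w]" "successively (bruhat_cover n) us"
      by (auto simp: saturated_chains_def)
    then have "successively (bruhat_cover n) (butlast us @ [w])" by simp
    from bound[OF this] us(1)
    show "us \<in> (\<lambda>us. us @ [w]) ` {us. set us \<subseteq> {u. u permutes {1..n}} \<and> length us \<le> perm_length n w}"
      by blast
  qed
  moreover have "finite {us. set us \<subseteq> {u. u permutes {1..n}} \<and> length us \<le> perm_length n w}"
    by (intro finite_lists_length_le finite_permutations) simp
  ultimately show ?thesis by (meson finite_imageI finite_subset)
qed

end

theory Submission imports Defs begin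

text \<open>All coefficients are nonnegative, so no cancellation occurs and the support is the union,
  over all saturated chains, of the Minkowski sums of the edge supports. For a cover
  \<open>v = u t\<^sub>a\<^sub>b\<close>, the inversions of \<open>u\<close> match those of \<open>v\<close> other than \<open>(a, b)\<close> in such a way that
  intervals only grow; hence every chain contributes a subset of the right-hand side. Conversely,
  a chain in the left weak order (swapping the values \<open>k\<close> and \<open>k + 1\<close>) adds to the inversion set
  exactly the pair of positions swapped in each step. Its edges run once through the inversions
  of \<open>w\<close>, and this single chain already contributes the whole right-hand side.\<close>

section \<open>Supports of polynomials with nonnegative coefficients\<close>

definition nonneg_poly :: "('a \<Rightarrow>\<^sub>0 'b::linordered_field) \<Rightarrow> bool" where
  "nonneg_poly p \<longleftrightarrow> (\<forall>k. 0 \<le> Poly_Mapping.lookup p k)"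

lemma nonneg_poly_sum: "(\<And>i. i \<in> I \<Longrightarrow> nonneg_poly (f i)) \<Longrightarrow> nonneg_poly (\<Sum>i\<in>I. f i)"
  by (auto simp: nonneg_poly_def lookup_sum intro: sum_nonneg)

lemma keys_sum_nonneg:
  assumes "finite I" "\<And>i. i \<in> I \<Longrightarrow> nonneg_poly (f i)"
  shows "Poly_Mapping.keys (\<Sum>i\<in>I. f i) = (\<Union>i\<in>I. Poly_Mapping.keys (f i))"
  using assms
  by (auto simp: set_eq_iff in_keys_iff lookup_sum nonneg_poly_def sum_nonneg_eq_0_iff)

lemma nonneg_poly_single: "0 \<le> c \<Longrightarrow> nonneg_poly (Poly_Mapping.single k c)"
  by (auto simp: nonneg_poly_def lookup_single when_def)

lemma nonneg_poly_one: "nonneg_poly 1"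
  using nonneg_poly_single[of 1 0] by simp

lemma poly_mapping_expand:
  "p = (\<Sum>k\<in>Poly_Mapping.keys p. Poly_Mapping.single k (Poly_Mapping.lookup p k))"
  by (rule poly_mapping_eqI) (auto simp: lookup_sum lookup_single when_def in_keys_iff)

text \<open>Turns a product into a finite sum of monomials, so that \<open>keys_sum_nonneg\<close>
  also governs products.\<close>

lemma mult_expand:
  fixes p q :: "'a::monoid_add \<Rightarrow>\<^sub>0 'b::linordered_field"
  shows "p * q = (\<Sum>(a, b)\<in>Poly_Mapping.keys p \<times> Poly_Mapping.keys q.
           Poly_Mapping.single (a + b) (Poly_Mapping.lookup p a * Poly_Mapping.lookup q b))"
proof -
  have "p * q = (\<Sum>a\<in>Poly_Mapping.keys p. Poly_Mapping.single a (Poly_Mapping.lookup p a)) *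
      (\<Sum>b\<in>Poly_Mapping.keys q. Poly_Mapping.single b (Poly_Mapping.lookup q b))"
    by (simp only: poly_mapping_expand[symmetric])
  then show ?thesis
    by (simp add: sum_product sum.cartesian_product mult_single)
qed

lemma
  fixes p q :: "'a::monoid_add \<Rightarrow>\<^sub>0 'b::linordered_field"
  assumes "nonneg_poly p" "nonneg_poly q"
  shows nonneg_poly_mult: "nonneg_poly (p * q)"
    and keys_mult_nonneg: "Poly_Mapping.keys (p * q) = Poly_Mapping.keys p + Poly_Mapping.keys q"
proof -
  have *: "nonneg_poly (case x of (a, b) \<Rightarrow>
      Poly_Mapping.single (a + b) (Poly_Mapping.lookup p a * Poly_Mapping.lookup q b))" for x
    using assms unfolding nonneg_poly_def[of p] nonneg_poly_def[of q]
    by (auto intro!: nonneg_poly_single split: prod.split)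
  show "nonneg_poly (p * q)"
    unfolding mult_expand by (rule nonneg_poly_sum) (rule *)
  show "Poly_Mapping.keys (p * q) = Poly_Mapping.keys p + Poly_Mapping.keys q"
  proof -
    \<comment> \<open>Each monomial has a product of two nonzero field elements as coefficient, so
      its support is exactly \<open>{a + b}\<close>.\<close>
    have "Poly_Mapping.keys (p * q) =
        (\<Union>(a, b)\<in>Poly_Mapping.keys p \<times> Poly_Mapping.keys q. {a + b})"
      unfolding mult_expand by (subst keys_sum_nonneg[OF _ *]) (auto simp: in_keys_iff intro!: SUP_cong)
    then show ?thesis by (auto simp: set_plus_image)
  qed
qed

section \<open>Weights of edges and chains\<close>

lemma
  assumes "inj u" "a < b"
  shows nonneg_edge_weight: "nonneg_poly (edge_weight u (u \<circ> transpose a b))"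
    and keys_edge_weight:
      "Poly_Mapping.keys (edge_weight u (u \<circ> transpose a b)) = unit_exp ` {a..<b}"
proof -
  have *: "nonneg_poly (Var i)" for i
    by (simp add: Var_def nonneg_poly_single)
  show "nonneg_poly (edge_weight u (u \<circ> transpose a b))"
    by (simp add: edge_weight_transpose assms * nonneg_poly_sum)
  show "Poly_Mapping.keys (edge_weight u (u \<circ> transpose a b)) = unit_exp ` {a..<b}"
    by (simp add: edge_weight_transpose assms * keys_sum_nonneg Var_def[abs_def] nonneg_poly_single)
       auto
qed

lemma chain_weight_snoc:
  assumes "us \<noteq> []"
  shows "chain_weight (us @ [v]) = chain_weight us * edge_weight (last us) v"
proof -
  obtain m where m: "length us = Suc m"
    using assms by (cases us) auto
  show ?thesis
    using assms by (simp add: chain_weight_def m nth_append last_conv_nth)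
qed

text \<open>The right-hand side of the theorem, named to serve as the invariant along chains.
  Addition of sets is the Minkowski sum.\<close>

definition inversion_exponents :: "nat \<Rightarrow> (nat \<Rightarrow> nat) \<Rightarrow> (nat \<Rightarrow>\<^sub>0 nat) set" where
  "inversion_exponents n w = (\<Sum>(a, b)\<in>inversions n w. unit_exp ` {a..<b})"

lemma inversion_exponents_id: "inversion_exponents n id = {0}"
proof -
  have "inversions n id = {}" by (auto simp: inversions_def)
  then show ?thesis by (simp add: inversion_exponents_def)
qed

section \<open>Inversions along a Bruhat cover\<close>

text \<open>An inversion \<open>(i, a)\<close> or \<open>(b, j)\<close> of \<open>u\<close> is lost
  in \<open>v\<close> when the value at \<open>i\<close> or \<open>j\<close> lies strictly between
  \<open>u a\<close> and \<open>u b\<close>; the longer pair \<open>(i, b)\<close> or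
  \<open>(a, j)\<close> replaces it. All other inversions persist.\<close>

lemma inversion_injection:
  fixes u :: "nat \<Rightarrow> nat"
  assumes u: "inj u" and ab: "1 \<le> a" "a < b" "b \<le> n" and less: "u a < u b"
  defines "v \<equiv> u \<circ> transpose a b"
  obtains \<phi> where "inj_on \<phi> (inversions n u)" "\<phi> ` inversions n u \<subseteq> inversions n v - {(a, b)}"
    "\<And>p. p \<in> inversions n u \<Longrightarrow> {fst p..<snd p} \<subseteq> {fst (\<phi> p)..<snd (\<phi> p)}"
proof
  let ?t = "transpose a b"
  define \<phi> where "\<phi> p = (if p \<in> inversions n v then p else (?t (fst p), ?t (snd p)))" for p
  have moved: "i < a \<and> j = a \<and> u a < u i \<and> u i < u b \<or> i = b \<and> b < j \<and> u a < u j \<and> u j < u b"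
    if "(i, j) \<in> inversions n u" "(i, j) \<notin> inversions n v" for i j
  proof -
    \<comment> \<open>Injectivity turns each failed comparison of values into a strict one in the
      other direction.\<close>
    have "u i \<noteq> u b" if "i \<noteq> b" using u that by (auto dest: injD)
    moreover have "u j \<noteq> u b" if "j \<noteq> b" using u that by (auto dest: injD)
    moreover have "u i \<noteq> u a" if "i \<noteq> a" using u that by (auto dest: injD)
    moreover have "u j \<noteq> u a" if "j \<noteq> a" using u that by (auto dest: injD)
    ultimately show ?thesis
      using that less ab
      by (auto simp: inversions_def v_def transpose_def split: if_splits)
  qed
  have phi: "(fst p = fst q \<or> fst q = a \<and> fst p = b) \<and> (snd p = snd q \<or> snd q = b \<and> snd p = a) \<and>
      q \<in> inversions n v - {(a, b)}"
    if "p \<in> inversions n u" "\<phi> p = q" for p q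
  proof (cases "p \<in> inversions n v")
    case True
    then show ?thesis using that less by (auto simp: \<phi>_def inversions_def)
  next
    case False
    with moved[of "fst p" "snd p"] that ab show ?thesis
      by (auto simp: \<phi>_def inversions_def v_def transpose_def)
  qed
  show "\<phi> ` inversions n u \<subseteq> inversions n v - {(a, b)}"
    by (rule image_subsetI) (use phi in blast)
  show "{fst p..<snd p} \<subseteq> {fst (\<phi> p)..<snd (\<phi> p)}" if "p \<in> inversions n u" for p
    using phi[OF that refl] ab by auto
  \<comment> \<open>A lost \<open>q\<close> is sent to \<open>(i, b)\<close> with
    \<open>u i < u b\<close> or to \<open>(a, j)\<close> with \<open>u a < u j\<close>. Neither is
    an inversion of \<open>u\<close>, so it cannot equal a persisting \<open>p\<close>.\<close>
  have not_both: False if "p \<in> inversions n u" "q \<in> inversions n u" "p \<in> inversions n v"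
    "q \<notin> inversions n v" "\<phi> p = \<phi> q" for p q
    using moved[of "fst q" "snd q"] that ab
    by (cases p; cases q) (auto simp: \<phi>_def inversions_def transpose_def)
  show "inj_on \<phi> (inversions n u)"
  proof (rule inj_onI)
    fix p q assume pq: "p \<in> inversions n u" "q \<in> inversions n u" "\<phi> p = \<phi> q"
    show "p = q"
    proof (cases "p \<in> inversions n v \<longleftrightarrow> q \<in> inversions n v")
      case True
      then show ?thesis using pq(3)
        by (auto simp: \<phi>_def prod_eq_iff split: if_splits) (metis transpose_involutory)+
    next
      case False
      then show ?thesis using not_both[of p q] not_both[of q p] pq by auto
    qed
  qed
qed

lemma set_plus_sum_mono:
  fixes A B :: "'a \<Rightarrow> 'b::comm_monoid_add set"
  assumes "\<And>i. i \<in> I \<Longrightarrow> A i \<subseteq> B i"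
  shows "(\<Sum>i\<in>I. A i) \<subseteq> (\<Sum>i\<in>I. B i)"
  using assms by (induction I rule: infinite_finite_induct) (simp_all add: set_plus_mono2)

text \<open>The length condition forces \<open>u a < u b\<close> and makes the injection a bijection
  onto the inversions of \<open>v\<close> other than \<open>(a, b)\<close>. Growing intervals then
  enlarge the summands, and the new edge supplies the one for \<open>(a, b)\<close>.\<close>

lemma inversion_exponents_cover:
  assumes u: "inj u" and ab: "1 \<le> a" "a < b" "b \<le> n" and v: "v = u \<circ> transpose a b"
    and len: "perm_length n v = perm_length n u + 1"
  shows "inversion_exponents n u + unit_exp ` {a..<b} \<subseteq> inversion_exponents n v"
proof -
  have inj_v: "inj v" unfolding v using u by (intro inj_compose) auto
  \<comment> \<open>Otherwise \<open>u\<close> arises from \<open>v\<close> by the same swap with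
    \<open>v a < v b\<close>, and the injection in the reverse direction bounds the length of
    \<open>v\<close> by that of \<open>u\<close>.\<close>
  have "u a < u b"
  proof (rule ccontr)
    assume "\<not> u a < u b"
    then have "v a < v b" 
      using ab injD[OF u, of a b] by (fastforce simp: v)
    moreover have "u = v \<circ> transpose a b" by (auto simp: v fun_eq_iff)
    ultimately obtain \<phi> where \<phi>: "inj_on \<phi> (inversions n v)" "\<phi> ` inversions n v \<subseteq> inversions n u - {(a, b)}"
      using inversion_injection[OF inj_v ab] by metis
    have "card (inversions n v) \<le> card (inversions n u)"
      using \<phi> by (intro card_inj_on_le[of \<phi>]) (auto simp: finite_inversions)
    then show False using len by (simp add: perm_length_def)
  qed
  with inversion_injection[OF u ab] obtain \<phi> where \<phi>: "inj_on \<phi> (inversions n u)"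
    "\<phi> ` inversions n u \<subseteq> inversions n v - {(a, b)}"
    "\<And>p. p \<in> inversions n u \<Longrightarrow> {fst p..<snd p} \<subseteq> {fst (\<phi> p)..<snd (\<phi> p)}"
    unfolding v by metis
  have ab_in: "(a, b) \<in> inversions n v"
    using \<open>u a < u b\<close> ab by (auto simp: inversions_def v)
  have img: "\<phi> ` inversions n u = inversions n v - {(a, b)}"
    using \<phi> len ab_in
    by (intro card_subset_eq) (auto simp: finite_inversions card_image perm_length_def)
  have "inversion_exponents n u \<subseteq> (\<Sum>p\<in>inversions n u. unit_exp ` {fst (\<phi> p)..<snd (\<phi> p)})"
    unfolding inversion_exponents_def case_prod_unfold
    using \<phi>(3) by (intro set_plus_sum_mono image_mono)
  also have "\<dots> = (\<Sum>p\<in>inversions n v - {(a, b)}. unit_exp ` {fst p..<snd p})"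
    using \<phi>(1) by (simp add: img[symmetric] sum.reindex)
  finally have "unit_exp ` {a..<b} + inversion_exponents n u \<subseteq>
      unit_exp ` {a..<b} + (\<Sum>p\<in>inversions n v - {(a, b)}. unit_exp ` {fst p..<snd p})"
    by (intro set_plus_mono2) auto
  also have "\<dots> = inversion_exponents n v"
    using ab_in by (simp add: inversion_exponents_def case_prod_unfold sum.remove[of _ "(a, b)"] finite_inversions)
  finally show ?thesis by (simp add: add.commute)
qed

section \<open>Upper bound for the support of a chain weight\<close>

text \<open>Induction on the top end of the chain. Both claims are proved together because the
  support of a product is computed from nonnegativity of its factors.\<close>

lemma
  assumes "us \<noteq> []" "hd us = id" "successively (bruhat_cover n) us"
  shows nonneg_chain_weight: "nonneg_poly (chain_weight us)"
    and keys_chain_weight_subset: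
      "Poly_Mapping.keys (chain_weight us) \<subseteq> inversion_exponents n (last us)"
proof -
  have "nonneg_poly (chain_weight us) \<and>
      Poly_Mapping.keys (chain_weight us) \<subseteq> inversion_exponents n (last us)"
    using assms
  proof (induction us rule: rev_induct)
    case (snoc v us)
    show ?case
    proof (cases "us = []")
      case True
      then have "v = id" using snoc.prems(2) by (metis append_Nil list.sel(1))
      show ?thesis unfolding True \<open>v = id\<close>
        by (simp add: chain_weight_def inversion_exponents_id[unfolded id_def] nonneg_poly_one)
    next
      case False
      with snoc have IH: "nonneg_poly (chain_weight us)"
          "Poly_Mapping.keys (chain_weight us) \<subseteq> inversion_exponents n (last us)"
        and cov: "bruhat_cover n (last us) v"
        by (auto simp: successively_append_iff)
      from cov obtain a b where ab: "1 \<le> a" "a < b" "b \<le> n" "v = last us \<circ> transpose a b"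
        "perm_length n v = perm_length n (last us) + 1" and inj: "inj (last us)"
        by (auto simp: bruhat_cover_def permutes_inj)
      note e = nonneg_edge_weight[OF inj ab(2), folded ab(4)]
      have "Poly_Mapping.keys (chain_weight us * edge_weight (last us) v) =
          Poly_Mapping.keys (chain_weight us) + unit_exp ` {a..<b}"
        by (simp add: keys_mult_nonneg IH e keys_edge_weight[OF inj ab(2), folded ab(4)])
      also have "\<dots> \<subseteq> inversion_exponents n (last us) + unit_exp ` {a..<b}"
        using IH by (intro set_plus_mono2) auto
      also have "\<dots> \<subseteq> inversion_exponents n v"
        by (rule inversion_exponents_cover[OF inj ab])
      finally show ?thesis using False by (simp add: chain_weight_snoc nonneg_poly_mult IH e)
    qed
  qed simp
  then show "nonneg_poly (chain_weight us)"
    "Poly_Mapping.keys (chain_weight us) \<subseteq> inversion_exponents n (last us)" by auto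
qed

section \<open>A chain attaining the whole Minkowski sum\<close>

text \<open>Without inversions \<open>w\<close> is strictly increasing on \<open>{1..n}\<close>, so
  \<open>i \<le> w i\<close> throughout, which only the identity satisfies.\<close>

lemma permutes_inversions_empty:
  assumes w: "w permutes {1..n}" and "inversions n w = {}"
  shows "w = id"
proof (rule permutes_natset_ge[OF w])
  have mono: "w i < w j" if "1 \<le> i" "i < j" "j \<le> n" for i j
    using that assms(2) permutes_inj[OF w, THEN injD, of i j]
    by (force simp: inversions_def)
  have "i \<le> w i" if "1 \<le> i" "i \<le> n" for i
    using that
  proof (induction i rule: dec_induct)
    case base
    then show ?case using permutes_in_image[OF w, of 1] by auto
  next
    case (step i)
    then show ?case using mono[of i "Suc i"] by auto
  qed
  then show "\<forall>i\<in>{1..n}. i \<le> w i" by auto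
qed

text \<open>An inversion with the smallest difference of values works: a larger gap would leave room
  for an inversion with a smaller one.\<close>

lemma exists_adjacent_inversion:
  assumes w: "w permutes {1..n}" and "w \<noteq> id"
  obtains a b where "(a, b) \<in> inversions n w" "w a = Suc (w b)"
proof -
  have "inversions n w \<noteq> {}"
    using assms permutes_inversions_empty by blast
  then obtain p where p: "p \<in> inversions n w"
    and min: "\<And>q. q \<in> inversions n w \<Longrightarrow> w (fst p) - w (snd p) \<le> w (fst q) - w (snd q)"
    using ex_has_least_nat[of "\<lambda>p. p \<in> inversions n w" _ "\<lambda>p. w (fst p) - w (snd p)"] by blast
  obtain a b where ab: "p = (a, b)" by (cases p)
  have inv: "1 \<le> a" "a < b" "b \<le> n" "w b < w a" using p by (auto simp: ab inversions_def)
  have "w a = Suc (w b)"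
  proof (rule ccontr)
    assume "w a \<noteq> Suc (w b)"
    then have lt: "Suc (w b) < w a" using inv by simp
    have "w a \<in> {1..n}" using permutes_in_image[OF w, of a] inv by auto
    then have "Suc (w b) \<in> {1..n}" using lt by auto
    then obtain c where c: "c \<in> {1..n}" "w c = Suc (w b)"
      using permutes_image[OF w] by (metis imageE)
    have "c \<noteq> a" using c lt by auto
    \<comment> \<open>If \<open>c\<close> lies right of \<open>a\<close>, the pair
      \<open>(a, c)\<close> has a gap smaller by one; if left, \<open>(c, b)\<close> has gap
      1.\<close>
    then have "(a, c) \<in> inversions n w \<or> (c, b) \<in> inversions n w"
      using c inv lt by (auto simp: inversions_def)
    then show False using min[of "(a, c)"] min[of "(c, b)"] c lt by (auto simp: ab)
  qed
  with p that ab show ?thesis by blast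
qed

text \<open>No third value lies between two consecutive values, so exchanging them changes no other
  comparison.\<close>

lemma inversions_swap_adjacent:
  assumes "inj w" "(a, b) \<in> inversions n w" "w a = Suc (w b)"
  shows "inversions n (w \<circ> transpose a b) = inversions n w - {(a, b)}"
proof -
  have eq: "w i = w j \<longleftrightarrow> i = j" for i j using assms(1) by (auto dest: injD)
  have "w (transpose a b j) < w (transpose a b i) \<longleftrightarrow> w j < w i"
    if "i < j" "(i, j) \<noteq> (a, b)" for i j
    using that assms(2,3) eq[of i a] eq[of i b] eq[of j a] eq[of j b]
    by (auto simp: transpose_def inversions_def)
  moreover have "\<not> w (transpose a b b) < w (transpose a b a)"
    using assms by simp
  ultimately have "p \<in> inversions n (w \<circ> transpose a b) \<longleftrightarrow> p \<in> inversions n w - {(a, b)}" for p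
    by (cases p; cases "p = (a, b)") (auto simp: inversions_def)
  then show ?thesis by blast
qed

text \<open>Induction on length. Undoing an adjacent-value inversion leaves all other inversions in
  place, so the last edge adds exactly the missing summand and equality is preserved.\<close>

lemma exists_full_chain:
  assumes "w permutes {1..n}"
  shows "\<exists>us\<in>saturated_chains n w. Poly_Mapping.keys (chain_weight us) = inversion_exponents n w"
  using assms
proof (induction "perm_length n w" arbitrary: w rule: less_induct)
  case less
  show ?case
  proof (cases "w = id")
    case True
    then show ?thesis
      by (intro bexI[of _ "[id]"])
        (simp_all add: saturated_chains_def chain_weight_def inversion_exponents_id)
  next
    case False
    with less.prems obtain a b where ab: "(a, b) \<in> inversions n w" "w a = Suc (w b)"
      using exists_adjacent_inversion by metis
    have "1 \<le> a" "a < b" "b \<le> n" using ab by (auto simp: inversions_def)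
    define u where "u = w \<circ> transpose a b"
    have u: "u permutes {1..n}"
      unfolding u_def using less.prems \<open>1 \<le> a\<close> \<open>a < b\<close> \<open>b \<le> n\<close>
      by (intro permutes_compose permutes_swap_id) auto
    have w: "w = u \<circ> transpose a b" by (auto simp: u_def fun_eq_iff)
    have inv: "inversions n u = inversions n w - {(a, b)}"
      unfolding u_def using inversions_swap_adjacent ab less.prems permutes_inj by blast
    have len: "perm_length n w = perm_length n u + 1"
      using card.remove[OF finite_inversions ab(1)] by (simp add: perm_length_def inv)
    have cov: "bruhat_cover n u w"
      unfolding bruhat_cover_def using u w len \<open>1 \<le> a\<close> \<open>a < b\<close> \<open>b \<le> n\<close> by blast
    obtain us where us: "us \<in> saturated_chains n u"
      "Poly_Mapping.keys (chain_weight us) = inversion_exponents n u"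
      using less.hyps[of u] u len by auto
    have "us @ [w] \<in> saturated_chains n w"
      using us(1) cov by (auto simp: saturated_chains_def successively_append_iff)
    moreover have "Poly_Mapping.keys (chain_weight (us @ [w])) = inversion_exponents n w"
    proof -
      have chain: "us \<noteq> []" "last us = u" "nonneg_poly (chain_weight us)"
        using us(1) nonneg_chain_weight by (auto simp: saturated_chains_def)
      have "Poly_Mapping.keys (chain_weight (us @ [w])) =
          inversion_exponents n u + unit_exp ` {a..<b}"
        using chain us(2) nonneg_edge_weight[OF permutes_inj[OF u] \<open>a < b\<close>]
          keys_edge_weight[OF permutes_inj[OF u] \<open>a < b\<close>]
        by (simp add: chain_weight_snoc keys_mult_nonneg flip: w)
      also have "\<dots> = inversion_exponents n w"
        using ab(1) by (simp add: inversion_exponents_def inv sum.remove[of _ "(a, b)"]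
            finite_inversions add.commute)
      finally show ?thesis .
    qed
    ultimately show ?thesis by blast
  qed
qed

theorem theorem1p2:
  fixes n :: nat and w :: "nat \<Rightarrow> nat"
  assumes "n \<ge> 1" and "w permutes {1..n}"
  shows "Poly_Mapping.keys (dual_schubert n w) =
           (\<Sum>(a, b)\<in>inversions n w. unit_exp ` {a..<b})"
proof -
  have nonneg: "nonneg_poly (chain_weight us)" if "us \<in> saturated_chains n w" for us
    using that nonneg_chain_weight by (auto simp: saturated_chains_def)
  \<comment> \<open>The factor \<open>1 / fact (perm_length n w)\<close> is a positive constant with
    support \<open>{0}\<close>, so it leaves the support unchanged.\<close>
  have "Poly_Mapping.keys (dual_schubert n w) =
      (\<Union>us\<in>saturated_chains n w. Poly_Mapping.keys (chain_weight us))"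
    by (simp add: dual_schubert_def Const_def keys_mult_nonneg nonneg_poly_single nonneg_poly_sum
        keys_sum_nonneg nonneg finite_saturated_chains)
  \<comment> \<open>Every chain stays inside the Minkowski sum, and the full chain fills it.\<close>
  also have "\<dots> = inversion_exponents n w"
    using exists_full_chain[OF assms(2)] keys_chain_weight_subset
    by (fastforce simp: saturated_chains_def)
  finally show ?thesis by (simp add: inversion_exponents_def)
qed

end
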